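(* Let $h:\mathbb{R}^n\to\mathbb{R}$ be continuously differentiable and strongly quasiconvex with modulus $\gamma>0$, and let $\overline{x}$ be its minimizer, $\{\overline{x}\}=\operatorname{argmin}_{\mathbb{R}^n}h$. Consider the dynamical system $$\dot x(t)+\nabla h(x(t))=0\quad(t>0),\qquad x(0)=x_0 .$$ Then the following assertions hold. (a) $t\mapsto h(x(t))$ is nonincreasing along any trajectory $x(t)$ of this system. (b) Any trajectory $x(t)$ of this system satisfies $$\|x(t)-\overline{x}\|\le\|x_0-\overline{x}\|\,e^{-\frac{\gamma}{2}t},$$ i.e. $x(t)$ converges exponentially to the unique minimizer $\overline{x}$ of $h$. (c) For any trajectory $x(t)$ of this system there exist $T>0$ and $L>0$ such that $$h(x(t))-h(\overline{x})\le\min\left\{\frac{L}{2}\|x_0-\overline{x}\|\,e^{-\frac{\gamma}{2}t},\ \bigl(h(x_0)-h(\overline{x})\bigr)e^{-\frac{\gamma^2}{2L}t}\right\}\quad\text{for all }t\ge T;$$ as a consequence, $h(x(t))$ converges exponentially to $h^*=\min_{\mathbb{R}^n}h$.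
   Context: $\|\cdot\|$ is the Euclidean norm on $\mathbb{R}^n$. A trajectory is a solution $x:[0,+\infty[\,\to\mathbb{R}^n$ of the system with initial point $x_0\in\mathbb{R}^n$. A function $h:\mathbb{R}^n\to\mathbb{R}$ is strongly quasiconvex with modulus $\gamma>0$ if for all $x,y\in\mathbb{R}^n$ and all $\lambda\in[0,1]$, $$h(\lambda y+(1-\lambda)x)\le\max\{h(y),h(x)\}-\lambda(1-\lambda)\frac{\gamma}{2}\|x-y\|^2.$$ It is known that a lower semicontinuous strongly quasiconvex function on $\mathbb{R}^n$ has exactly one minimizer. *)

theory Defs
  imports "HOL-Analysis.Analysis"
begin

definition strongly_quasiconvex :: "real \<Rightarrow> ('a::real_normed_vector \<Rightarrow> real) \<Rightarrow> bool" where
  "strongly_quasiconvex \<gamma> h \<longleftrightarrow>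
     \<gamma> > 0 \<and>
     (\<forall>x y. \<forall>l\<in>{0..1}.
        h (l *\<^sub>R y + (1 - l) *\<^sub>R x) \<le> max (h y) (h x) - l * (1 - l) * (\<gamma> / 2) * (norm (x - y))\<^sup>2)"

text \<open>
  Solutions of \<open>x' + G x = 0\<close> for \<open>t > 0\<close> with \<open>x 0 = x0\<close>. Only the values on \<open>[0, \<infinity>)\<close> matter.
  At \<open>t = 0\<close> only continuity from the right is required, since the equation is imposed for
  \<open>t > 0\<close> only.
\<close>
definition trajectory :: "('a::real_normed_vector \<Rightarrow> 'a) \<Rightarrow> 'a \<Rightarrow> (real \<Rightarrow> 'a) \<Rightarrow> bool" where
  "trajectory G x0 x \<longleftrightarrow>
     continuous_on {0..} x \<and> x 0 = x0 \<and>
     (\<forall>t>0. (x has_vector_derivative - G (x t)) (at t))"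

definition converges_exponentially :: "(real \<Rightarrow> 'a::real_normed_vector) \<Rightarrow> 'a \<Rightarrow> bool" where
  "converges_exponentially f l \<longleftrightarrow>
     (\<exists>C c. c > 0 \<and> (\<forall>t\<ge>0. norm (f t - l) \<le> C * exp (- c * t)))"

end

theory Submission
  imports Defs
begin

text \<open>
  Comparing a point \<open>z\<close> with the minimizer along the segment between them, strong quasiconvexity
  yields \<open>grad h z \<bullet> (z - xbar) \<ge> \<gamma>/2 * (norm (z - xbar))\<^sup>2\<close>, so that
  \<open>exp (\<gamma> t) * (norm (x t - xbar))\<^sup>2\<close> decreases along a trajectory. The gradient is bounded on
  the ball around \<open>xbar\<close> through \<open>x0\<close>, so \<open>h (x t) - h xbar\<close> inherits the decay rate \<open>\<gamma>/2\<close>.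
  For \<open>L \<ge> 2\<gamma>\<close> the rate \<open>\<gamma>\<^sup>2/(2L)\<close> is at most \<open>\<gamma>/4\<close>, and the remaining factor \<open>exp (-\<gamma>t/4)\<close>
  absorbs all constants for large \<open>t\<close>.
\<close>

text \<open>Since \<open>h y \<le> h z\<close>, the maximum in the definition of strong
  quasiconvexity is \<open>h z\<close>. Dividing the inequality by \<open>l > 0\<close> bounds the
  difference quotient at \<open>z\<close> towards \<open>y\<close>, and letting \<open>l\<close>
  tend to 0 turns this quotient into \<open>(y - z) \<bullet> g\<close>.\<close>

lemma strongly_quasiconvex_gradient:
  fixes h :: "'a::real_inner \<Rightarrow> real"
  assumes qc: "strongly_quasiconvex \<gamma> h" and grad: "GDERIV h z :> g" and le: "h y \<le> h z"
  shows "\<gamma> / 2 * (norm (z - y))\<^sup>2 \<le> g \<bullet> (z - y)"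
proof -
  let ?p = "\<lambda>l::real. l *\<^sub>R y + (1 - l) *\<^sub>R z"
  have "(?p has_derivative (\<lambda>l. l *\<^sub>R (y - z))) (at 0)"
    by (auto intro!: derivative_eq_intros simp: algebra_simps)
  moreover have "(h has_derivative (\<lambda>v. v \<bullet> g)) (at (?p 0))"
    using grad by (simp add: gderiv_def)
  ultimately have "((\<lambda>l. h (?p l)) has_derivative (\<lambda>l. l *\<^sub>R (y - z) \<bullet> g)) (at 0)"
    by (rule has_derivative_compose)
  then have "((\<lambda>l. h (?p l)) has_real_derivative (y - z) \<bullet> g) (at 0)"
    by (rule has_derivative_imp_has_field_derivative) simp
  \<comment> \<open>The quasiconvexity inequality covers only \<open>l\<close> in the unit interval,
    so the two-sided limit is restricted to the right-hand one.\<close>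
  then have "((\<lambda>l. (h (?p l) - h z) / l) \<longlongrightarrow> (y - z) \<bullet> g) (at_right 0)"
    by (auto simp: has_field_derivative_iff intro: filterlim_mono[OF _ order_refl at_le])
  moreover have "((\<lambda>l. - ((1 - l) * (\<gamma> / 2) * (norm (z - y))\<^sup>2)) \<longlongrightarrow>
      - ((1 - 0) * (\<gamma> / 2) * (norm (z - y))\<^sup>2)) (at_right 0)"
    by (intro tendsto_intros)
  moreover have "\<forall>\<^sub>F l in at_right 0.
      (h (?p l) - h z) / l \<le> - ((1 - l) * (\<gamma> / 2) * (norm (z - y))\<^sup>2)"
  proof -
    have "(h (?p l) - h z) / l \<le> - ((1 - l) * (\<gamma> / 2) * (norm (z - y))\<^sup>2)"
      if "0 < l" "l < 1" for l
    proof -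
      have "h (?p l) \<le> max (h y) (h z) - l * (1 - l) * (\<gamma> / 2) * (norm (z - y))\<^sup>2"
        using qc that unfolding strongly_quasiconvex_def by (meson atLeastAtMost_iff less_imp_le)
      then have "h (?p l) - h z \<le> - ((1 - l) * (\<gamma> / 2) * (norm (z - y))\<^sup>2) * l"
        using le by (simp add: algebra_simps)
      then show ?thesis
        using that by (simp only: pos_divide_le_eq)
    qed
    then show ?thesis
      unfolding eventually_at_right_field by (meson zero_less_one)
  qed
  ultimately have "(y - z) \<bullet> g \<le> - ((1 - 0) * (\<gamma> / 2) * (norm (z - y))\<^sup>2)"
    by (intro tendsto_le[OF trivial_limit_at_right_real])
  then show ?thesis
    by (simp add: inner_commute inner_diff_left inner_diff_right)
qed

lemma trajectory_has_real_derivative: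
  assumes "trajectory G x0 x" "t > 0" "\<And>z. GDERIV h z :> G z"
  shows "((\<lambda>t. h (x t)) has_real_derivative - (norm (G (x t)))\<^sup>2) (at t)"
proof -
  have "(x has_derivative (\<lambda>s. s *\<^sub>R (- G (x t)))) (at t)"
    using assms by (simp add: trajectory_def has_vector_derivative_def)
  moreover have "(h has_derivative (\<lambda>v. v \<bullet> G (x t))) (at (x t))"
    using assms by (simp add: gderiv_def)
  ultimately have "((\<lambda>t. h (x t)) has_derivative (\<lambda>s. s *\<^sub>R (- G (x t)) \<bullet> G (x t))) (at t)"
    by (rule has_derivative_compose)
  then show ?thesis
    by (rule has_derivative_imp_has_field_derivative) (simp add: power2_norm_eq_inner)
qed

text \<open>Along the flow the derivative of \<open>h (x t)\<close> is minus the squared norm of the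
  gradient. The equation holds for positive times only, so the monotonicity criterion used asks for
  derivatives inside the interval and continuity up to its ends.\<close>

lemma trajectory_antimono:
  fixes h :: "'a::real_inner \<Rightarrow> real"
  assumes traj: "trajectory G x0 x" and grad: "\<And>z. GDERIV h z :> G z"
  shows "antimono_on {0..} (\<lambda>t. h (x t))"
proof (rule monotone_onI)
  fix s t :: real assume st: "s \<in> {0..}" "t \<in> {0..}" "s \<le> t"
  have "isCont h z" for z
    using grad[of z] by (auto simp: gderiv_def intro: has_derivative_continuous)
  then have "continuous_on UNIV h"
    by (simp add: continuous_at_imp_continuous_on)
  moreover have "continuous_on {s..t} x"
    using traj st by (auto simp: trajectory_def intro: continuous_on_subset)
  ultimately have "continuous_on {s..t} (\<lambda>t. h (x t))"
    by (rule continuous_on_compose2) simp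
  moreover have "\<exists>y. ((\<lambda>t. h (x t)) has_real_derivative y) (at u) \<and> y \<le> 0" if "s < u" for u
    using trajectory_has_real_derivative[OF traj _ grad, of u] st that by force
  ultimately show "h (x t) \<le> h (x s)"
    using st by (intro DERIV_nonpos_imp_decreasing_open[of s t]) auto
qed

text \<open>A Lyapunov argument with the weighted energy \<open>?E\<close>: the weight contributes
  \<open>2 * c\<close> times the squared distance to the derivative, and \<open>mono\<close> says
  that the flow removes at least as much. Squaring the norm keeps the energy differentiable even
  where \<open>x u = y\<close>.\<close>

lemma trajectory_norm_decay:
  fixes G :: "'a::real_inner \<Rightarrow> 'a"
  assumes traj: "trajectory G x0 x" and mono: "\<And>z. c * (norm (z - y))\<^sup>2 \<le> G z \<bullet> (z - y)"
    and "t \<ge> 0"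
  shows "norm (x t - y) \<le> norm (x0 - y) * exp (- c * t)"
proof -
  let ?E = "\<lambda>t. exp (2 * c * t) * ((x t - y) \<bullet> (x t - y))"
  have "?E t \<le> ?E 0"
  proof (rule DERIV_nonpos_imp_decreasing_open[where f = ?E])
    show "\<exists>d. (?E has_real_derivative d) (at u) \<and> d \<le> 0" if "0 < u" for u
    proof (intro exI conjI)
      have "((\<lambda>t. x t - y) has_derivative (\<lambda>s. s *\<^sub>R (- G (x u)))) (at u)"
        using traj that
        by (auto simp: trajectory_def has_vector_derivative_def intro!: derivative_eq_intros)
      from has_derivative_inner[OF this this]
      have "((\<lambda>t. (x t - y) \<bullet> (x t - y)) has_real_derivative - 2 * (G (x u) \<bullet> (x u - y))) (at u)"
        by (rule has_derivative_imp_has_field_derivative) (simp add: inner_commute)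
      note [derivative_intros] = this
      show "(?E has_real_derivative
          exp (2 * c * u) * (2 * c * ((x u - y) \<bullet> (x u - y)) - 2 * (G (x u) \<bullet> (x u - y)))) (at u)"
        by (rule derivative_eq_intros refl)+ (simp add: algebra_simps)
      show "exp (2 * c * u) * (2 * c * ((x u - y) \<bullet> (x u - y)) - 2 * (G (x u) \<bullet> (x u - y))) \<le> 0"
        using mono[of "x u"] by (intro mult_nonneg_nonpos) (auto simp: power2_norm_eq_inner)
    qed
    have "continuous_on {0..t} x"
      using traj by (auto simp: trajectory_def intro: continuous_on_subset)
    then show "continuous_on {0..t} ?E"
      by (intro continuous_intros)
  qed (use \<open>t \<ge> 0\<close> in auto)
  \<comment> \<open>The weight \<open>exp (2 * c * t)\<close> is the square of
    \<open>exp (c * t)\<close>, so the energy inequality compares two squares.\<close>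
  then have "(exp (c * t) * norm (x t - y))\<^sup>2 \<le> (norm (x0 - y))\<^sup>2"
    using traj by (simp add: trajectory_def power_mult_distrib power2_norm_eq_inner
        flip: exp_double mult.assoc)
  then have "exp (c * t) * norm (x t - y) \<le> norm (x0 - y)"
    by (rule power2_le_imp_le) simp
  then show ?thesis
    by (simp add: exp_minus field_simps)
qed

text \<open>The continuous gradient is bounded on the compact ball, and the ball is convex, so the
  mean value inequality applies on it.\<close>

lemma gradient_lipschitz_at_centre:
  fixes h :: "'a::euclidean_space \<Rightarrow> real"
  assumes grad: "\<And>z. GDERIV h z :> G z" and cont: "continuous_on UNIV G"
  obtains M where "M > 0" "\<And>z. z \<in> cball y r \<Longrightarrow> h z - h y \<le> M * norm (z - y)"
proof -
  have "bounded (G ` cball y r)"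
    using cont by (intro compact_imp_bounded compact_continuous_image compact_cball)
      (auto intro: continuous_on_subset)
  then obtain M where M: "M > 0" "\<And>z. z \<in> cball y r \<Longrightarrow> norm (G z) \<le> M"
    by (auto simp: bounded_pos)
  have "h z - h y \<le> M * norm (z - y)" if z: "z \<in> cball y r" for z
  proof -
    have "norm (h z - h y) \<le> M * norm (z - y)"
    proof (rule differentiable_bound[OF convex_cball])
      show "(h has_derivative (\<lambda>v. v \<bullet> G w)) (at w within cball y r)" for w
        using grad[of w] by (simp add: gderiv_def has_derivative_at_withinI)
      show "onorm (\<lambda>v. v \<bullet> G w) \<le> M" if "w \<in> cball y r" for w
      proof (rule onorm_bound)
        fix v
        have "norm (v \<bullet> G w) \<le> norm (G w) * norm v"
          using Cauchy_Schwarz_ineq2[of v "G w"] by (simp add: mult.commute)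
        also have "\<dots> \<le> M * norm v"
          using M(2)[OF that] by (intro mult_right_mono) auto
        finally show "norm (v \<bullet> G w) \<le> M * norm v" .
      qed (use M in simp)
      \<comment> \<open>The centre lies in the ball only if \<open>0 \<le> r\<close>; this follows
        from the ball containing \<open>z\<close>.\<close>
      have "dist y z \<le> r" using z by simp
      then show "y \<in> cball y r"
        using zero_le_dist[of y z] by (simp del: zero_le_dist)
    qed (use z in simp)
    then show ?thesis by simp
  qed
  with M(1) show thesis by (rule that)
qed

theorem theorem16:
  fixes h :: "real ^ 'n \<Rightarrow> real"
    and grad_h :: "real ^ 'n \<Rightarrow> real ^ 'n"
    and xbar x0 :: "real ^ 'n"
    and \<gamma> :: real
  assumes gradient: "\<And>z. GDERIV h z :> grad_h z"
    and continuous_gradient: "continuous_on UNIV grad_h"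
    and quasiconvex: "strongly_quasiconvex \<gamma> h"
    and minimizer: "{xbar} = {z. is_arg_min h (\<lambda>_. True) z}"
  shows "(\<forall>x. trajectory grad_h x0 x \<longrightarrow> antimono_on {0..} (\<lambda>t. h (x t))) \<and>
    (\<forall>x. trajectory grad_h x0 x \<longrightarrow>
       (\<forall>t\<ge>0. norm (x t - xbar) \<le> norm (x0 - xbar) * exp (- (\<gamma> / 2) * t)) \<and>
       converges_exponentially x xbar) \<and>
    (\<forall>x. trajectory grad_h x0 x \<longrightarrow>
       (\<exists>T>0. \<exists>L>0. \<forall>t\<ge>T.
          h (x t) - h xbar \<le>
            min (L / 2 * norm (x0 - xbar) * exp (- (\<gamma> / 2) * t))
                ((h x0 - h xbar) * exp (- (\<gamma>\<^sup>2 / (2 * L)) * t))) \<and>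
       converges_exponentially (\<lambda>t. h (x t)) (INF z. h z))"
proof (intro conjI allI impI)
  have \<gamma>: "\<gamma> > 0"
    using quasiconvex by (simp add: strongly_quasiconvex_def)
  have "xbar \<in> {z. is_arg_min h (\<lambda>_. True) z}"
    using minimizer by blast
  then have min: "h xbar \<le> h z" for z
    by (simp add: is_arg_min_linorder)
  fix x assume traj: "trajectory grad_h x0 x"
  show anti: "antimono_on {0..} (\<lambda>t. h (x t))"
    using traj gradient by (rule trajectory_antimono)
  show decay: "norm (x t - xbar) \<le> norm (x0 - xbar) * exp (- (\<gamma> / 2) * t)" if "0 \<le> t" for t
    using traj strongly_quasiconvex_gradient[OF quasiconvex gradient min] that
    by (rule trajectory_norm_decay)
  show "converges_exponentially x xbar"
    unfolding converges_exponentially_def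
    using \<gamma> decay by (intro exI[of _ "norm (x0 - xbar)"] exI[of _ "\<gamma> / 2"]) auto

  obtain M where M: "M > 0"
    "\<And>z. z \<in> cball xbar (norm (x0 - xbar)) \<Longrightarrow> h z - h xbar \<le> M * norm (z - xbar)"
    using gradient_lipschitz_at_centre[OF gradient continuous_gradient] by metis
  let ?K = "norm (x0 - xbar)"
  have value_decay: "h (x t) - h xbar \<le> M * ?K * exp (- (\<gamma> / 2) * t)" if "0 \<le> t" for t
  proof -
    \<comment> \<open>The exponential factor is at most 1, so the trajectory never leaves the ball
      on which \<open>M\<close> is valid.\<close>
    have "?K * exp (- (\<gamma> / 2) * t) \<le> ?K * 1"
      using \<gamma> that by (intro mult_left_mono) auto
    with decay[OF that] have "x t \<in> cball xbar ?K"
      by (simp add: dist_norm norm_minus_commute)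
    from M(2)[OF this] have "h (x t) - h xbar \<le> M * norm (x t - xbar)" .
    also have "\<dots> \<le> M * (?K * exp (- (\<gamma> / 2) * t))"
      using M(1) decay[OF that] by (intro mult_left_mono) auto
    finally show ?thesis by (simp add: mult.assoc)
  qed
  have inf: "(INF z. h z) = h xbar"
    using min by (intro cInf_eq_minimum) auto
  show "converges_exponentially (\<lambda>t. h (x t)) (INF z. h z)"
    unfolding converges_exponentially_def inf
    using \<gamma> value_decay min by (intro exI[of _ "M * ?K"] exI[of _ "\<gamma> / 2"]) auto

  \<comment> \<open>The entry \<open>2 * M\<close> gives the first bound from
    \<open>value_decay\<close>; the entry \<open>2 * \<gamma>\<close> makes the rate in the second
    bound at most \<open>\<gamma> / 4\<close>.\<close>
  define L where "L = max (2 * M) (2 * \<gamma>)"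
  have L: "L > 0" "M \<le> L / 2" "2 * \<gamma> \<le> L"
    using \<gamma> by (auto simp: L_def)
  have first: "h (x t) - h xbar \<le> L / 2 * ?K * exp (- (\<gamma> / 2) * t)" if "0 \<le> t" for t
  proof -
    have "M * ?K * exp (- (\<gamma> / 2) * t) \<le> L / 2 * ?K * exp (- (\<gamma> / 2) * t)"
      using L by (intro mult_right_mono) auto
    with value_decay[OF that] show ?thesis by linarith
  qed
  have "\<exists>T>0. \<forall>t\<ge>T. M * ?K * exp (- (\<gamma> / 4) * t) \<le> h x0 - h xbar"
  proof (cases "x0 = xbar")
    \<comment> \<open>Here \<open>?K = 0\<close>, so both sides vanish and any positive
      \<open>T\<close> works.\<close>
    case True
    then show ?thesis by (auto intro: exI[of _ 1])
  next
    case False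
    \<comment> \<open>Uniqueness of the minimizer makes the gap strictly positive, so a quantity
      tending to 0 eventually drops below it.\<close>
    then have "h xbar < h x0"
      using minimizer min by (metis is_arg_min_linorder mem_Collect_eq not_le_imp_less
          order_trans singletonD)
    moreover have "((\<lambda>t. M * ?K * exp (- (\<gamma> / 4) * t)) \<longlongrightarrow> M * ?K * 0) at_top"
      using \<gamma> by (intro tendsto_intros filterlim_compose[OF exp_at_bot]
          filterlim_tendsto_neg_mult_at_bot[OF tendsto_const _ filterlim_ident]) auto
    ultimately have "\<forall>\<^sub>F t in at_top. M * ?K * exp (- (\<gamma> / 4) * t) < h x0 - h xbar"
      by (intro order_tendstoD) auto
    then obtain T where "\<And>t. t \<ge> T \<Longrightarrow> M * ?K * exp (- (\<gamma> / 4) * t) < h x0 - h xbar"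
      by (auto simp: eventually_at_top_linorder)
    then show ?thesis
      by (intro exI[of _ "max 1 T"]) (auto intro: less_imp_le)
  qed
  then obtain T where T: "T > 0" "\<And>t. t \<ge> T \<Longrightarrow> M * ?K * exp (- (\<gamma> / 4) * t) \<le> h x0 - h xbar"
    by blast
  have second: "h (x t) - h xbar \<le> (h x0 - h xbar) * exp (- (\<gamma>\<^sup>2 / (2 * L)) * t)" if "T \<le> t" for t
  proof -
    have "\<gamma>\<^sup>2 / (2 * L) \<le> \<gamma> / 4"
      using \<gamma> L by (simp add: field_simps power2_eq_square)
    then have rate: "exp (- (\<gamma> / 4) * t) \<le> exp (- (\<gamma>\<^sup>2 / (2 * L)) * t)"
      using T(1) that mult_right_mono[of "\<gamma>\<^sup>2 / (2 * L)" "\<gamma> / 4" t] by simp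
    \<comment> \<open>The decay \<open>exp (- (\<gamma> / 2) * t)\<close> is split into two equal
      factors: by the choice of \<open>T\<close>, the first brings \<open>M * ?K\<close> below the
      initial gap, and the second supplies the required rate.\<close>
    have "h (x t) - h xbar \<le> M * ?K * exp (- (\<gamma> / 4) * t) * exp (- (\<gamma> / 4) * t)"
      using value_decay[of t] T(1) that by (simp add: mult.assoc flip: exp_add)
    also have "\<dots> \<le> (h x0 - h xbar) * exp (- (\<gamma>\<^sup>2 / (2 * L)) * t)"
      using T(2)[OF that] rate min[of x0] by (intro mult_mono) auto
    finally show ?thesis .
  qed
  show "\<exists>T>0. \<exists>L>0. \<forall>t\<ge>T. h (x t) - h xbar \<le>
      min (L / 2 * ?K * exp (- (\<gamma> / 2) * t)) ((h x0 - h xbar) * exp (- (\<gamma>\<^sup>2 / (2 * L)) * t))"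
    using T(1) L(1) first second by (intro exI[of _ T] exI[of _ L] conjI allI impI) auto
qed

end
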